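(* Let $n\ge2$ and $X=\{1,\dots,n\}$. Let $\mathrm{F}_1,\mathrm{F}_2\colon[0,\infty)^2\to[0,\infty)$ be such that the pair $(\mathrm{F}_1,\mathrm{F}_2)$ is pairwise $2$-increasing, $\mathrm{F}_1$ is nondecreasing (that is, $\mathrm{F}_1(a,b)\le\mathrm{F}_1(c,d)$ whenever $a\le c$ and $b\le d$), $\mathrm{F}_1\ge\mathrm{F}_2$ pointwise, and $\mathrm{F}_2(0,b)=0$ for all $b\in[0,\infty)$. Then for every $f\colon X\to[0,\infty)$ and every symmetric monotone measure $\mu$ on $2^X$, $$\sup_{\{D_l\subset\dots\subset D_1\}\in\mathcal{H}_{\mathrm{chain}}}\ \sum_{i=1}^{l}\Big(\mathrm{F}_1\big(\mathsf{A}^{\inf}(f|D_i),\mu(D_i)\big)-\mathrm{F}_2\big(\mathsf{A}^{\inf}(f|D_{i-1}),\mu(D_i)\big)\Big)=\mathfrak{C}^{(\mathrm{F}_1,\mathrm{F}_2)}_{\mu}(f),$$ where $D_0=\emptyset$.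
   Context: A monotone measure on $2^X$ is a function $\mu\colon 2^X\to[0,\infty)$ with $\mu(\emptyset)=0$ and $\mu(C)\le\mu(D)$ whenever $C\subset D$. It is symmetric if $|C|=|D|$ implies $\mu(C)=\mu(D)$. A pair $(\mathrm{F}_1,\mathrm{F}_2)$ of functions $[0,\infty)^2\to[0,\infty)$ is pairwise $2$-increasing if $\mathrm{F}_1(x_1,y_2)-\mathrm{F}_2(x_1,y_1)\le\mathrm{F}_1(x_2,y_2)-\mathrm{F}_2(x_2,y_1)$ for every rectangle $[x_1,x_2]\times[y_1,y_2]\subseteq[0,\infty)^2$ (so $x_1\le x_2$, $y_1\le y_2$). $\mathsf{A}^{\inf}(f|D)=\inf_{x\in D}f(x)$ for nonempty $D$, and $\mathsf{A}^{\inf}(f|\emptyset)=0$. $\mathcal{H}_{\mathrm{chain}}$ is the family of all chains $\{D_l,\dots,D_1\}$, $l\ge1$, of nonempty subsets of $X$ with strict inclusions $D_l\subset\dots\subset D_1$ ($D_1$ need not equal $X$). For $f\colon X\to[0,\infty)$ let $(\cdot)$ be a permutation of $X$ with $f_{(1)}\le\dots\le f_{(n)}$, $f_{(i)}=f((i))$, $f_{(0)}=0$, $B_{(i)}=\{(i),\dots,(n)\}$. Define $$\mathfrak{C}^{(\mathrm{F}_1,\mathrm{F}_2)}_{\mu}(f)=\sum_{i=1}^n\big(\mathrm{F}_1(f_{(i)},\mu(B_{(i)}))-\mathrm{F}_2(f_{(i-1)},\mu(B_{(i)}))\big),$$ which does not depend on the permutation when $\mu$ is symmetric. The left-hand side of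 the equality is the special case of the Choquet-Sugeno-like operator $\sup_{\mathcal{D}\in\mathcal{H}}\sum_{(C,D)\in\mathcal{R}}\mathrm{L}(\mathsf{A}(f|C),\widehat{\mathsf{A}}(f|D),\mu(C),\widehat{\mu}(D))$ with $\mathcal{H}=\mathcal{H}_{\mathrm{chain}}$, $\mathcal{R}=\{(D_1,D_0),\dots,(D_l,D_{l-1})\}$, $\mathsf{A}=\widehat{\mathsf{A}}=\mathsf{A}^{\inf}$, $\mathrm{L}(x,y,z,w)=\mathrm{F}_1(x,z)-\mathrm{F}_2(y,z)$. *)

theory Defs
  imports Complex_Main "HOL-Combinatorics.Permutations"
begin

text \<open>The half-line $[0,\infty)$ is rendered by \<^typ>\<open>real\<close> with explicit sign conditions. Set functions on
  $2^X$ and functions on $X$ are total functions of which only the values on subsets,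
  respectively elements, of $X$ are used.\<close>

definition monotone_measure :: "'a set \<Rightarrow> ('a set \<Rightarrow> real) \<Rightarrow> bool" where
  "monotone_measure X \<mu> \<longleftrightarrow>
     \<mu> {} = 0 \<and> (\<forall>C. C \<subseteq> X \<longrightarrow> 0 \<le> \<mu> C) \<and> (\<forall>C D. C \<subseteq> D \<longrightarrow> D \<subseteq> X \<longrightarrow> \<mu> C \<le> \<mu> D)"

definition symmetric_measure :: "'a set \<Rightarrow> ('a set \<Rightarrow> real) \<Rightarrow> bool" where
  "symmetric_measure X \<mu> \<longleftrightarrow>
     (\<forall>C D. C \<subseteq> X \<longrightarrow> D \<subseteq> X \<longrightarrow> card C = card D \<longrightarrow> \<mu> C = \<mu> D)"

definition pairwise_2_increasing ::
    "(real \<Rightarrow> real \<Rightarrow> real) \<Rightarrow> (real \<Rightarrow> real \<Rightarrow> real) \<Rightarrow> bool" where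
  "pairwise_2_increasing F1 F2 \<longleftrightarrow>
     (\<forall>x1 x2 y1 y2. 0 \<le> x1 \<longrightarrow> x1 \<le> x2 \<longrightarrow> 0 \<le> y1 \<longrightarrow> y1 \<le> y2 \<longrightarrow>
        F1 x1 y2 - F2 x1 y1 \<le> F1 x2 y2 - F2 x2 y1)"

definition A_inf :: "('a \<Rightarrow> real) \<Rightarrow> 'a set \<Rightarrow> real" where
  "A_inf f D = (if D = {} then 0 else (INF x\<in>D. f x))"

text \<open>A chain $D_l \subset \dots \subset D_1$ is encoded as the list $[D_1, \dots, D_l]$, largest
  set first; strictness makes this a bijection with finite nonempty chains of nonempty sets.\<close>

definition H_chain :: "'a set \<Rightarrow> 'a set list set" where
  "H_chain X = {Ds. Ds \<noteq> [] \<and> (\<forall>D\<in>set Ds. D \<noteq> {} \<and> D \<subseteq> X) \<and> sorted_wrt (\<lambda>C D. D \<subset> C) Ds}"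

text \<open>Prepending \<^term>\<open>{}\<close> provides $D_0 = \emptyset$ and makes position $i$ hold $D_i$.\<close>

definition chain_sum ::
    "(real \<Rightarrow> real \<Rightarrow> real) \<Rightarrow> (real \<Rightarrow> real \<Rightarrow> real) \<Rightarrow> ('a set \<Rightarrow> real) \<Rightarrow> ('a \<Rightarrow> real) \<Rightarrow>
     'a set list \<Rightarrow> real" where
  "chain_sum F1 F2 \<mu> f Ds =
     (\<Sum>i = 1..length Ds.
        F1 (A_inf f (({} # Ds) ! i)) (\<mu> (({} # Ds) ! i))
      - F2 (A_inf f (({} # Ds) ! (i - 1))) (\<mu> (({} # Ds) ! i)))"

definition ordering_perm :: "nat \<Rightarrow> (nat \<Rightarrow> real) \<Rightarrow> (nat \<Rightarrow> nat) \<Rightarrow> bool" where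
  "ordering_perm n f \<sigma> \<longleftrightarrow> \<sigma> permutes {1..n} \<and> (\<forall>i\<in>{1..n}. \<forall>j\<in>{1..n}. i \<le> j \<longrightarrow> f (\<sigma> i) \<le> f (\<sigma> j))"

definition f_ord :: "(nat \<Rightarrow> real) \<Rightarrow> (nat \<Rightarrow> nat) \<Rightarrow> nat \<Rightarrow> real" where
  "f_ord f \<sigma> i = (if i = 0 then 0 else f (\<sigma> i))"

definition B_ord :: "nat \<Rightarrow> (nat \<Rightarrow> nat) \<Rightarrow> nat \<Rightarrow> nat set" where
  "B_ord n \<sigma> i = \<sigma> ` {i..n}"

text \<open>The operator is taken relative to an ordering permutation \<open>\<sigma>\<close>; results about it are stated
  for every such \<open>\<sigma>\<close>.\<close>

definition gen_Choquet ::
    "nat \<Rightarrow> (real \<Rightarrow> real \<Rightarrow> real) \<Rightarrow> (real \<Rightarrow> real \<Rightarrow> real) \<Rightarrow> (nat set \<Rightarrow> real) \<Rightarrow>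
     (nat \<Rightarrow> nat) \<Rightarrow> (nat \<Rightarrow> real) \<Rightarrow> real" where
  "gen_Choquet n F1 F2 \<mu> \<sigma> f =
     (\<Sum>i = 1..n. F1 (f_ord f \<sigma> i) (\<mu> (B_ord n \<sigma> i))
                - F2 (f_ord f \<sigma> (i - 1)) (\<mu> (B_ord n \<sigma> i)))"

text \<open>The following facts show that quantifying over ordering permutations is not vacuous and
  that the supremum over \<^const>\<open>H_chain\<close> is one over a finite nonempty set.\<close>

lemma ordering_perm_exists: "\<exists>\<sigma>. ordering_perm n f \<sigma>"
proof -
  define xs where "xs = sort_key f [1..<Suc n]"
  have len: "length xs = n" by (simp add: xs_def)
  have dist: "distinct xs" by (simp add: xs_def)
  have set: "set xs = {1..n}" by (auto simp: xs_def)
  have srt: "sorted (map f xs)" unfolding xs_def by (rule sorted_sort_key)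
  define \<sigma> where "\<sigma> i = (if i \<in> {1..n} then xs ! (i - 1) else i)" for i
  have "bij_betw ((!) xs) {..<n} {1..n}"
    using bij_betw_nth[OF dist, of "{..<n}" "{1..n}"] len set by simp
  moreover have "bij_betw (\<lambda>i. i - 1) {1..n} {..<n}"
    by (rule bij_betw_byWitness[where f' = Suc]) auto
  ultimately have "bij_betw ((!) xs \<circ> (\<lambda>i. i - 1)) {1..n} {1..n}"
    by (rule bij_betw_trans[rotated])
  then have "bij_betw \<sigma> {1..n} {1..n}"
    by (rule bij_betw_cong[THEN iffD1, rotated]) (simp add: \<sigma>_def)
  then have "\<sigma> permutes {1..n}"
    by (rule bij_imp_permutes) (auto simp: \<sigma>_def)
  moreover have "f (\<sigma> i) \<le> f (\<sigma> j)" if "i \<in> {1..n}" "j \<in> {1..n}" "i \<le> j" for i j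
  proof -
    have "map f xs ! (i - 1) \<le> map f xs ! (j - 1)"
      by (rule sorted_nth_mono[OF srt]) (use that len in auto)
    then show ?thesis using that len by (auto simp: \<sigma>_def)
  qed
  ultimately show ?thesis unfolding ordering_perm_def by blast
qed

lemma finite_H_chain:
  assumes "finite X"
  shows "finite (H_chain X)"
proof (rule finite_subset)
  show "H_chain X \<subseteq> {Ds. set Ds \<subseteq> Pow X \<and> distinct Ds}"
  proof
    fix Ds assume "Ds \<in> H_chain X"
    then have "set Ds \<subseteq> Pow X" "sorted_wrt (\<lambda>C D. D \<subset> C) Ds" by (auto simp: H_chain_def)
    moreover from this(2) have "distinct Ds" by (induction Ds) auto
    ultimately show "Ds \<in> {Ds. set Ds \<subseteq> Pow X \<and> distinct Ds}" by simp
  qed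
  show "finite {Ds. set Ds \<subseteq> Pow X \<and> distinct Ds}"
    using finite_subset_distinct[of "Pow X"] assms by simp
qed

lemma H_chain_nonempty: "X \<noteq> {} \<Longrightarrow> H_chain X \<noteq> {}"
  by (auto simp: H_chain_def intro!: exI[of _ "[X]"])

end

(* In a chain sum the term F1(a_i, m_i) - F2(a_i, m_(i+1)) is nondecreasing in a_i, because the pair is
   pairwise 2-increasing and m_(i+1) <= m_i; so A_inf f D_i may be raised to the largest infimum of f
   over a set of the same cardinality, namely f_(k) with k = n + 1 - card D_i, while symmetry of the
   measure gives mu(D_i) = mu(B_(k)). The result is the sum over a subsequence of the points
   (f_(k), mu(B_(k))), and inserting a missing point never decreases the sum. The full sum is attained
   by the chain of the sets B_(k). *)

theory Submission
  imports Defs "HOL-Library.Sublist"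
begin

section \<open>Recursive form of the chain sum and of the generalized Choquet operator\<close>

fun path_sum :: "('a \<Rightarrow> 'b \<Rightarrow> real) \<Rightarrow> ('a \<Rightarrow> 'b \<Rightarrow> real) \<Rightarrow> 'a \<Rightarrow> ('a \<times> 'b) list \<Rightarrow> real" where
  "path_sum F1 F2 x [] = 0"
| "path_sum F1 F2 x ((v, m) # ps) = F1 v m - F2 x m + path_sum F1 F2 v ps"

text \<open>Each summand involves two neighbouring entries; \<open>path_sum\<close> carries the
  earlier value as an argument, so that later inductions on the list need no indices. The entry
  \<open>e\<close> supplies the value preceding the first point: \<open>{}\<close> for chains, index
  0 for the Choquet sum, both with value 0.\<close>

lemma path_sum_map:
  "path_sum F1 F2 (v e) (map (\<lambda>d. (v d, m d)) ds) =
     (\<Sum>i = 1..length ds. F1 (v ((e # ds) ! i)) (m ((e # ds) ! i))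
                        - F2 (v ((e # ds) ! (i - 1))) (m ((e # ds) ! i)))"
proof (induction ds arbitrary: e)
  case (Cons d ds)
  let ?t = "\<lambda>l i. F1 (v (l ! i)) (m (l ! i)) - F2 (v (l ! (i - 1))) (m (l ! i))"
  have "(\<Sum>i = 1..Suc (length ds). ?t (e # d # ds) i)
      = ?t (e # d # ds) 1 + (\<Sum>i = Suc 1..Suc (length ds). ?t (e # d # ds) i)"
    by (rule sum.atLeast_Suc_atMost) simp
  also have "(\<Sum>i = Suc 1..Suc (length ds). ?t (e # d # ds) i)
      = (\<Sum>i = 1..length ds. ?t (e # d # ds) (Suc i))"
    by (rule sum.shift_bounds_cl_Suc_ivl)
  also have "\<dots> = (\<Sum>i = 1..length ds. ?t (d # ds) i)"
    by (intro sum.cong) (auto simp: nth_Cons')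
  finally show ?case by (simp add: Cons.IH)
qed simp

lemma chain_sum_eq_path_sum:
  "chain_sum F1 F2 \<mu> f Ds = path_sum F1 F2 0 (map (\<lambda>D. (A_inf f D, \<mu> D)) Ds)"
  using path_sum_map[of F1 F2 "A_inf f" "{}" \<mu> Ds] by (simp add: chain_sum_def A_inf_def)

lemma gen_Choquet_eq_path_sum:
  "gen_Choquet n F1 F2 \<mu> \<sigma> f =
     path_sum F1 F2 0 (map (\<lambda>i. (f_ord f \<sigma> i, \<mu> (B_ord n \<sigma> i))) [1..<Suc n])"
proof -
  have "(0 # [1..<Suc n]) ! i = i" if "i \<le> n" for i
    using that by (cases i) (auto simp del: upt_Suc)
  then have "gen_Choquet n F1 F2 \<mu> \<sigma> f =
      (\<Sum>i = 1..length [1..<Suc n].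
         F1 (f_ord f \<sigma> ((0 # [1..<Suc n]) ! i)) (\<mu> (B_ord n \<sigma> ((0 # [1..<Suc n]) ! i)))
       - F2 (f_ord f \<sigma> ((0 # [1..<Suc n]) ! (i - 1))) (\<mu> (B_ord n \<sigma> ((0 # [1..<Suc n]) ! i))))"
    unfolding gen_Choquet_def by (intro sum.cong) (auto simp del: upt_Suc)
  then show ?thesis
    using path_sum_map[of F1 F2 "f_ord f \<sigma>" 0 "\<lambda>i. \<mu> (B_ord n \<sigma> i)" "[1..<Suc n]"]
    by (simp add: f_ord_def)
qed

section \<open>Inequalities between path sums for a pairwise 2-increasing pair\<close>

locale two_increasing_pair =
  fixes F1 F2 :: "real \<Rightarrow> real \<Rightarrow> real"
  assumes two_increasing: "pairwise_2_increasing F1 F2"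
    and F1_mono: "\<And>a b c d. 0 \<le> a \<Longrightarrow> 0 \<le> b \<Longrightarrow> a \<le> c \<Longrightarrow> b \<le> d \<Longrightarrow> F1 a b \<le> F1 c d"
    and F2_le_F1: "\<And>a b. 0 \<le> a \<Longrightarrow> 0 \<le> b \<Longrightarrow> F2 a b \<le> F1 a b"
begin

lemma increment_mono:
  "0 \<le> x \<Longrightarrow> x \<le> x' \<Longrightarrow> 0 \<le> m \<Longrightarrow> m \<le> y \<Longrightarrow> F1 x y - F2 x m \<le> F1 x' y - F2 x' m"
  using two_increasing unfolding pairwise_2_increasing_def by blast

text \<open>If \<open>ps\<close> starts with \<open>(w, k)\<close>, the gain is (F1 v m - F2 v k) -
  (F2 x m - F2 x k). Since k \<le> m, lowering v to x can only decrease it, to F1 x m - F2 x m \<ge>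
  0. If \<open>ps\<close> is empty, the gain F1 v m - F2 x m is at least this same quantity.\<close>

lemma path_sum_insert:
  assumes "0 \<le> x" "x \<le> v" "0 \<le> m" "\<forall>p\<in>set ps. 0 \<le> snd p \<and> snd p \<le> m"
  shows "path_sum F1 F2 x ps \<le> path_sum F1 F2 x ((v, m) # ps)"
proof (cases ps)
  case Nil
  then show ?thesis using F2_le_F1[of x m] F1_mono[of x m v m] assms by simp
next
  case (Cons p qs)
  obtain w k where "p = (w, k)" by (cases p)
  then show ?thesis using Cons F2_le_F1[of x m] increment_mono[of x v k m] assms by auto
qed

definition monotone_path :: "(real \<times> real) list \<Rightarrow> bool" where
  "monotone_path ps \<longleftrightarrow>
     sorted_wrt (\<lambda>p q. fst p \<le> fst q \<and> snd q \<le> snd p) ps \<and> (\<forall>p\<in>set ps. 0 \<le> snd p)"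

lemma path_sum_subseq:
  assumes "subseq ps qs" "monotone_path qs" "0 \<le> x" "\<forall>q\<in>set qs. x \<le> fst q"
  shows "path_sum F1 F2 x ps \<le> path_sum F1 F2 x qs"
  using assms
proof (induction arbitrary: x rule: list_emb.induct)
  \<comment> \<open>The empty list embeds into every \<open>qs\<close>, so this case needs an
    induction of its own that inserts all points of \<open>qs\<close>, the last one first.\<close>
  case (list_emb_Nil qs)
  then show ?case
  proof (induction qs)
    case (Cons q qs)
    then have "path_sum F1 F2 x [] \<le> path_sum F1 F2 x qs" by (auto simp: monotone_path_def)
    also have "\<dots> \<le> path_sum F1 F2 x ((fst q, snd q) # qs)"
      by (rule path_sum_insert) (use Cons.prems in \<open>auto simp: monotone_path_def\<close>)
    finally show ?case by simp
  qed simp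
next
  case (list_emb_Cons ps qs q)
  then have "path_sum F1 F2 x ps \<le> path_sum F1 F2 x qs" by (auto simp: monotone_path_def)
  also have "\<dots> \<le> path_sum F1 F2 x ((fst q, snd q) # qs)"
    by (rule path_sum_insert) (use list_emb_Cons.prems in \<open>auto simp: monotone_path_def\<close>)
  finally show ?case by simp
next
  case (list_emb_Cons2 p q ps qs)
  \<comment> \<open>Equal heads contribute equal terms and both sums continue from
    \<open>fst q\<close>; hence the generalization over \<open>x\<close>.\<close>
  then have "path_sum F1 F2 (fst q) ps \<le> path_sum F1 F2 (fst q) qs"
    by (auto simp: monotone_path_def)
  then show ?case using list_emb_Cons2.hyps by (cases q) simp
qed

text \<open>The added terms \<open>F1 x y\<close> and \<open>F1 x' y\<close> pair up with the leading \<open>F2\<close> terms of the path sums, so that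
  the induction step compares two increments; they cancel when \<open>x = x'\<close>.\<close>

lemma path_sum_raise:
  assumes "list_all2 (\<lambda>p q. 0 \<le> fst p \<and> fst p \<le> fst q \<and> snd p = snd q) ps qs"
    and "sorted_wrt (\<lambda>p q. snd q \<le> snd p) qs" "\<forall>q\<in>set qs. 0 \<le> snd q \<and> snd q \<le> y"
    and "0 \<le> x" "x \<le> x'" "0 \<le> y"
  shows "F1 x y + path_sum F1 F2 x ps \<le> F1 x' y + path_sum F1 F2 x' qs"
  using assms
proof (induction ps qs arbitrary: x x' y rule: list_all2_induct)
  case Nil
  then show ?case using F1_mono[of x y x' y] by simp
next
  case (Cons p ps q qs)
  obtain a m b where pq: "p = (a, m)" "q = (b, m)"
    using Cons.hyps by (cases p; cases q) auto
  have "F1 a m + path_sum F1 F2 a ps \<le> F1 b m + path_sum F1 F2 b qs"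
    by (rule Cons.IH) (use Cons pq in auto)
  moreover have "F1 x y - F2 x m \<le> F1 x' y - F2 x' m"
    by (rule increment_mono) (use Cons pq in auto)
  ultimately show ?case using pq by simp
qed

end

section \<open>Infima, cardinalities and the sets \<open>B_ord\<close>\<close>

lemma A_inf_nonneg:
  assumes "\<And>x. x \<in> D \<Longrightarrow> 0 \<le> f x"
  shows "0 \<le> A_inf f D"
  using assms by (auto simp: A_inf_def intro!: cINF_greatest)

lemma card_B_ord:
  assumes "ordering_perm n f \<sigma>"
  shows "card (B_ord n \<sigma> k) = Suc n - k"
proof -
  have "inj_on \<sigma> {k..n}"
    using assms by (meson ordering_perm_def permutes_inj_on)
  then show ?thesis by (simp add: B_ord_def card_image)
qed

lemma B_ord_subset:
  assumes "ordering_perm n f \<sigma>" "1 \<le> k"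
  shows "B_ord n \<sigma> k \<subseteq> {1..n}"
proof -
  have "\<sigma> ` {1..n} = {1..n}"
    using assms by (meson ordering_perm_def permutes_image)
  then show ?thesis using assms unfolding B_ord_def by force
qed

lemma A_inf_B_ord:
  assumes "ordering_perm n f \<sigma>" "k \<in> {1..n}"
  shows "A_inf f (B_ord n \<sigma> k) = f_ord f \<sigma> k"
proof -
  have "(INF x\<in>\<sigma> ` {k..n}. f x) = f (\<sigma> k)"
    by (rule cInf_eq_minimum) (use assms in \<open>auto simp: ordering_perm_def\<close>)
  then show ?thesis using assms by (auto simp: A_inf_def B_ord_def f_ord_def)
qed

lemma f_ord_mono:
  assumes "ordering_perm n f \<sigma>" "1 \<le> i" "i \<le> j" "j \<le> n"
  shows "f_ord f \<sigma> i \<le> f_ord f \<sigma> j"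
  using assms by (auto simp: ordering_perm_def f_ord_def)

text \<open>By counting, a set of \<open>c\<close> indices meets the \<open>n + 1 - c\<close> indices with the smallest values.\<close>

lemma A_inf_le_f_ord:
  assumes ord: "ordering_perm n f \<sigma>" and D: "D \<subseteq> {1..n}" "D \<noteq> {}"
  shows "A_inf f D \<le> f_ord f \<sigma> (Suc n - card D)"
proof -
  let ?k = "Suc n - card D"
  have fin: "finite D" using D finite_subset by blast
  have card: "0 < card D" "card D \<le> n"
    using D fin card_mono[of "{1..n}" D] by (auto simp: card_gt_0_iff)
  have im: "\<sigma> ` {1..n} = {1..n}" and inj: "inj_on \<sigma> {1..?k}"
    using ord by (meson ordering_perm_def permutes_image permutes_inj_on)+
  have "D \<inter> \<sigma> ` {1..?k} \<noteq> {}"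
  proof
    assume "D \<inter> \<sigma> ` {1..?k} = {}"
    then have "card (D \<union> \<sigma> ` {1..?k}) = card D + ?k"
      using fin inj by (simp add: card_Un_disjoint card_image)
    moreover have "\<sigma> ` {1..?k} \<subseteq> \<sigma> ` {1..n}"
      using card by (intro image_mono) auto
    then have "D \<union> \<sigma> ` {1..?k} \<subseteq> {1..n}"
      using D(1) im by blast
    then have "card (D \<union> \<sigma> ` {1..?k}) \<le> n"
      using card_mono[of "{1..n}"] by fastforce
    ultimately show False using card by simp
  qed
  then obtain i where i: "1 \<le> i" "i \<le> ?k" "\<sigma> i \<in> D" by auto
  have "A_inf f D \<le> f (\<sigma> i)"
    using i D fin by (auto simp: A_inf_def intro!: cINF_lower)
  also have "\<dots> = f_ord f \<sigma> i" using i by (simp add: f_ord_def)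
  also have "\<dots> \<le> f_ord f \<sigma> ?k" using f_ord_mono[OF ord] i card by simp
  finally show ?thesis .
qed

text \<open>A strictly increasing list is determined by its set, so \<open>xs\<close> is what
  filtering the interval by membership in \<open>xs\<close> leaves.\<close>

lemma subseq_upt:
  assumes "sorted_wrt (<) xs" "set xs \<subseteq> {a..<b}"
  shows "subseq xs [a..<b]"
proof -
  have "xs = filter (\<lambda>x. x \<in> set xs) [a..<b]"
    by (rule sorted_distinct_set_unique)
      (use assms in \<open>auto simp: strict_sorted_iff intro: sorted_filter[where f = id, simplified]\<close>)
  then show ?thesis by (metis subseq_filter_left)
qed

lemma B_ord_in_H_chain:
  assumes "ordering_perm n f \<sigma>" "n \<ge> 1"
  shows "map (B_ord n \<sigma>) [1..<Suc n] \<in> H_chain {1..n}"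
proof -
  have "B_ord n \<sigma> j \<subset> B_ord n \<sigma> i" if "i < j" "j \<le> n" for i j
  proof -
    \<comment> \<open>Inclusion is clear from the index ranges; strictness comes from the differing
      cardinalities.\<close>
    have "card (B_ord n \<sigma> j) \<noteq> card (B_ord n \<sigma> i)"
      using that card_B_ord[OF assms(1)] by simp
    then show ?thesis using that by (auto simp: B_ord_def)
  qed
  then have "sorted_wrt (\<lambda>C D. D \<subset> C) (map (B_ord n \<sigma>) [1..<Suc n])"
    unfolding sorted_wrt_map by (intro sorted_wrt_mono_rel[OF _ sorted_wrt_upt]) (simp del: upt_Suc)
  moreover have "B_ord n \<sigma> i \<noteq> {}" if "i \<le> n" for i using that by (simp add: B_ord_def)
  ultimately show ?thesis
    using B_ord_subset[OF assms(1)] assms(2) by (auto simp: H_chain_def simp del: upt_Suc)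
qed

theorem theorem4p13:
  fixes n :: nat
    and F1 F2 :: "real \<Rightarrow> real \<Rightarrow> real"
    and f :: "nat \<Rightarrow> real"
    and \<mu> :: "nat set \<Rightarrow> real"
    and \<sigma> :: "nat \<Rightarrow> nat"
  assumes "n \<ge> 2"
    and "\<And>a b. 0 \<le> a \<Longrightarrow> 0 \<le> b \<Longrightarrow> 0 \<le> F1 a b"
    and "\<And>a b. 0 \<le> a \<Longrightarrow> 0 \<le> b \<Longrightarrow> 0 \<le> F2 a b"
    and "pairwise_2_increasing F1 F2"
    and "\<And>a b c d. 0 \<le> a \<Longrightarrow> 0 \<le> b \<Longrightarrow> a \<le> c \<Longrightarrow> b \<le> d \<Longrightarrow> F1 a b \<le> F1 c d"
    and "\<And>a b. 0 \<le> a \<Longrightarrow> 0 \<le> b \<Longrightarrow> F2 a b \<le> F1 a b"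
    and "\<And>b. 0 \<le> b \<Longrightarrow> F2 0 b = 0"
    and "\<And>x. x \<in> {1..n} \<Longrightarrow> 0 \<le> f x"
    and "monotone_measure {1..n} \<mu>"
    and "symmetric_measure {1..n} \<mu>"
    and "ordering_perm n f \<sigma>"
  shows "(SUP Ds\<in>H_chain {1..n}. chain_sum F1 F2 \<mu> f Ds) = gen_Choquet n F1 F2 \<mu> \<sigma> f"
proof -
  note f_nonneg = assms(8) and ord = assms(11)
  interpret two_increasing_pair F1 F2
    using assms(4-6) by unfold_locales
  have \<mu>_nonneg: "0 \<le> \<mu> C" if "C \<subseteq> {1..n}" for C
    using assms(9) that by (auto simp: monotone_measure_def)
  have \<mu>_mono: "\<mu> C \<le> \<mu> D" if "C \<subseteq> D" "D \<subseteq> {1..n}" for C D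
    using assms(9) that by (auto simp: monotone_measure_def)
  define p where "p i = (f_ord f \<sigma> i, \<mu> (B_ord n \<sigma> i))" for i
  have Choquet: "gen_Choquet n F1 F2 \<mu> \<sigma> f = path_sum F1 F2 0 (map p [1..<Suc n])"
    unfolding gen_Choquet_eq_path_sum p_def ..
  have path: "monotone_path (map p [1..<Suc n])"
  proof -
    have "fst (p i) \<le> fst (p j) \<and> snd (p j) \<le> snd (p i)" if "1 \<le> i" "i < j" "j \<le> n" for i j
      using f_ord_mono[OF ord, of i j] \<mu>_mono[OF _ B_ord_subset[OF ord], of "B_ord n \<sigma> j" i] that
        image_mono[of "{j..n}" "{i..n}" \<sigma>]
      by (simp add: p_def B_ord_def)
    then show ?thesis
      using \<mu>_nonneg B_ord_subset[OF ord]
      by (auto simp: monotone_path_def p_def sorted_wrt_map simp del: upt_Suc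
          intro!: sorted_wrt_mono_rel[OF _ sorted_wrt_upt])
  qed
  have p_nonneg: "0 \<le> fst (p i)" if "i \<in> {1..n}" for i
  proof -
    have "0 \<le> A_inf f (B_ord n \<sigma> i)"
      by (rule A_inf_nonneg) (use f_nonneg B_ord_subset[OF ord, of i] that in auto)
    then show ?thesis using A_inf_B_ord[OF ord that] by (simp add: p_def)
  qed
  have upper: "chain_sum F1 F2 \<mu> f Ds \<le> gen_Choquet n F1 F2 \<mu> \<sigma> f" if "Ds \<in> H_chain {1..n}" for Ds
  proof -
    define k where "k D = Suc n - card D" for D :: "nat set"
    have D: "D \<subseteq> {1..n}" "D \<noteq> {}" if "D \<in> set Ds" for D
      using that \<open>Ds \<in> H_chain {1..n}\<close> by (auto simp: H_chain_def)
    have srt: "sorted_wrt (\<lambda>C D. D \<subset> C) Ds"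
      using that by (simp add: H_chain_def)
    have fin: "finite D" if "D \<in> set Ds" for D
      using D(1)[OF that] finite_subset by blast
    \<comment> \<open>Nonemptiness of D gives \<open>k D\<close> \<le> n, and D \<subseteq> {1..n}
      gives 1 \<le> \<open>k D\<close>; the truncated subtraction is therefore exact.\<close>
    have k: "k D \<in> {1..n}" if "D \<in> set Ds" for D
    proof -
      have "0 < card D" "card D \<le> n"
        using D[OF that] fin[OF that] card_mono[of "{1..n}" D] by (auto simp: card_gt_0_iff)
      then show ?thesis unfolding k_def atLeastAtMost_iff by linarith
    qed
    \<comment> \<open>Strictness of the chain makes the indices strictly increasing, so no point is
      repeated and they form a subsequence of 1, ..., n.\<close>
    have k_less: "k C < k D" if "D \<subset> C" "C \<in> set Ds" "D \<in> set Ds" for C D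
      using psubset_card_mono[OF fin[OF that(2)] that(1)] k[OF that(2)]
      unfolding k_def atLeastAtMost_iff by linarith
    have \<mu>_k: "\<mu> (B_ord n \<sigma> (k D)) = \<mu> D" if "D \<in> set Ds" for D
    proof -
      have "card (B_ord n \<sigma> (k D)) = card D"
        using card_B_ord[OF ord, of "k D"] k[OF that] unfolding k_def atLeastAtMost_iff by linarith
      moreover have "B_ord n \<sigma> (k D) \<subseteq> {1..n}"
        by (rule B_ord_subset[OF ord]) (use k[OF that] in simp)
      ultimately show ?thesis
        using assms(10) D(1)[OF that] unfolding symmetric_measure_def by blast
    qed
    have raised: "list_all2 (\<lambda>p q. 0 \<le> fst p \<and> fst p \<le> fst q \<and> snd p = snd q)
        (map (\<lambda>D. (A_inf f D, \<mu> D)) Ds) (map p (map k Ds))"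
    proof -
      have "0 \<le> A_inf f D" if "D \<in> set Ds" for D
        using D(1)[OF that] f_nonneg by (intro A_inf_nonneg) blast
      moreover have "A_inf f D \<le> f_ord f \<sigma> (k D)" if "D \<in> set Ds" for D
        unfolding k_def by (rule A_inf_le_f_ord[OF ord D[OF that]])
      ultimately show ?thesis
        by (simp add: list_all2_map1 list_all2_map2 list_all2_same p_def \<mu>_k)
    qed
    have sub: "subseq (map k Ds) [1..<Suc n]"
    proof (rule subseq_upt)
      show "sorted_wrt (<) (map k Ds)"
        unfolding sorted_wrt_map by (rule sorted_wrt_mono_rel[OF _ srt]) (auto intro: k_less)
      show "set (map k Ds) \<subseteq> {1..<Suc n}" using k by (auto simp: less_Suc_eq_le)
    qed
    have snd_p: "snd (p (k D)) = \<mu> D" if "D \<in> set Ds" for D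
      using \<mu>_k that by (simp add: p_def)
    \<comment> \<open>The common summand is the auxiliary term of \<open>path_sum_raise\<close> for
      x = x' = 0; the height \<mu> {1..n} bounds all measures in the chain.\<close>
    have "F1 0 (\<mu> {1..n}) + chain_sum F1 F2 \<mu> f Ds
        \<le> F1 0 (\<mu> {1..n}) + path_sum F1 F2 0 (map p (map k Ds))"
      unfolding chain_sum_eq_path_sum
    proof (rule path_sum_raise[OF raised])
      show "sorted_wrt (\<lambda>p q. snd q \<le> snd p) (map p (map k Ds))"
        unfolding sorted_wrt_map
        by (rule sorted_wrt_mono_rel[OF _ srt]) (simp add: snd_p \<mu>_mono[OF psubset_imp_subset D(1)])
      show "\<forall>q\<in>set (map p (map k Ds)). 0 \<le> snd q \<and> snd q \<le> \<mu> {1..n}"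
        using D(1) \<mu>_mono \<mu>_nonneg by (simp add: snd_p)
    qed (use \<mu>_nonneg in auto)
    also have "path_sum F1 F2 0 (map p (map k Ds)) \<le> path_sum F1 F2 0 (map p [1..<Suc n])"
      by (rule path_sum_subseq[OF subseq_map[OF sub] path]) (use p_nonneg in \<open>auto simp del: upt_Suc\<close>)
    finally show ?thesis by (simp add: Choquet)
  qed
  have attained: "chain_sum F1 F2 \<mu> f (map (B_ord n \<sigma>) [1..<Suc n]) = gen_Choquet n F1 F2 \<mu> \<sigma> f"
  proof -
    \<comment> \<open>The infimum of f over \<open>B_ord n \<sigma> i\<close> is the i-th ordered
      value, so this chain runs through every point \<open>p i\<close>.\<close>
    have "map (\<lambda>D. (A_inf f D, \<mu> D)) (map (B_ord n \<sigma>) [1..<Suc n]) = map p [1..<Suc n]"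
      by (auto simp: p_def A_inf_B_ord[OF ord] simp del: upt_Suc)
    then show ?thesis by (simp only: chain_sum_eq_path_sum Choquet)
  qed
  show ?thesis
  \<comment> \<open>The supremum is a maximum: one chain attains the upper bound, which also settles
    nonemptiness and boundedness.\<close>
  proof (rule cSup_eq_maximum)
    show "gen_Choquet n F1 F2 \<mu> \<sigma> f \<in> chain_sum F1 F2 \<mu> f ` H_chain {1..n}"
      using B_ord_in_H_chain[OF ord] assms(1) attained by (intro image_eqI) auto
  qed (use upper in auto)
qed

end
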